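(* For all combinatorial games $G$ and $H$, if $G$ is iteratively zero, then the Conway product $GH$ is iteratively zero; in particular, $GH$ is Conway zero.
   Context: Games: a combinatorial game $G$ is a (possibly infinite, possibly partizan) well-founded two-player game of perfect information under normal play, given by a set of Left options $G^L$ and a set of Right options $G^R$, which are themselves games; one writes $G=\{\,G^L\mid G^R\,\}$. Games are taken as forms, considered up to extensional equality. $0=\{\,\mid\,\}$. Operations: $G+H$ has Left options $G^L+H$, $G+H^L$ and Right options $G^R+H$, $G+H^R$. $-G=\{\,-G^R\mid -G^L\,\}$, and $G-H=G+(-H)$. The Conway product $GH$ has Left options $G^LH+GH^L-G^LH^L$ and $G^RH+GH^R-G^RH^R$, and Right options $G^LH+GH^R-G^LH^R$ and $G^RH+GH^L-G^RH^L$, for arbitrary options of $G$ and $H$. Iteratively zero: recursively, $G$ is iteratively zero if for every Left option $G^L$ of $G$ there is a Right option $G^{LR}$ of $G^L$ which is iteratively zero, and for every Right option $G^R$ of $G$ there is a Left option $G^{RL}$ of $G^R$ which is iteratively zero. Conway zero: $G$ is Conway zero if the player moving second has a winning strategy on $G$ (whichever of Left and Right moves first). *)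

theory Defs
  imports "HOL-Library.Equipollence"
begin

section \<open>Games as extensional forms\<close>

text \<open>
  All combinatorial games form a proper class, so no single HOL type contains them all.  For every
  type \<open>'i\<close>, the type \<open>'i game\<close> built below consists of the well-founded two-sided hereditary sets
  in which every game has at most as many Left (and Right) options as the infinite type \<open>'i + nat\<close>
  has elements.  Any two such sets of options form a game (\<open>Game_opts\<close>), a game is determined by its
  options (\<open>game_eqI\<close>), option chains are well-founded (\<open>game_induct\<close>), and the cardinality bound
  is respected by sums, negatives and Conway products.  A statement polymorphic in \<open>'i\<close>
  therefore ranges over games with option sets of arbitrary cardinality.

  In the auxiliary type \<open>pre_game\<close> the option sets are enumerated by \<open>'i + nat\<close> (the value
  \<^term>\<open>None\<close> allows for fewer options); games are its quotient by extensional equality, so that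
  order and multiplicity of the enumeration are forgotten.
\<close>

datatype 'i pre_game =
  Pre_Game "'i + nat \<Rightarrow> 'i pre_game option" "'i + nat \<Rightarrow> 'i pre_game option"

primrec pre_left :: "'i pre_game \<Rightarrow> 'i pre_game set" where
  "pre_left (Pre_Game l r) = ran l"

primrec pre_right :: "'i pre_game \<Rightarrow> 'i pre_game set" where
  "pre_right (Pre_Game l r) = ran r"

lemma pre_game_induct:
  assumes "\<And>p. (\<And>q. q \<in> pre_left p \<union> pre_right p \<Longrightarrow> P q) \<Longrightarrow> P p"
  shows "P p"
proof (induction p)
  case (Pre_Game l r)
  show ?case
  proof (rule assms)
    fix q assume "q \<in> pre_left (Pre_Game l r) \<union> pre_right (Pre_Game l r)"
    then obtain i where "l i = Some q \<or> r i = Some q" by (auto simp: ran_def)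
    then show "P q" using Pre_Game by (metis option.set_intros rangeI)
  qed
qed

inductive ext_eq :: "'i pre_game \<Rightarrow> 'i pre_game \<Rightarrow> bool" where
  "\<lbrakk>\<forall>x\<in>pre_left p. \<exists>y\<in>pre_left q. ext_eq x y; \<forall>y\<in>pre_left q. \<exists>x\<in>pre_left p. ext_eq x y;
    \<forall>x\<in>pre_right p. \<exists>y\<in>pre_right q. ext_eq x y; \<forall>y\<in>pre_right q. \<exists>x\<in>pre_right p. ext_eq x y\<rbrakk>
   \<Longrightarrow> ext_eq p q"

lemma ext_eq_refl: "ext_eq p p"
  by (induction p rule: pre_game_induct) (rule ext_eq.intros; blast)

lemma ext_eq_sym: "ext_eq p q \<Longrightarrow> ext_eq q p"
  by (induction rule: ext_eq.induct) (rule ext_eq.intros; blast)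

lemma ext_eq_trans: "ext_eq p q \<Longrightarrow> ext_eq q r \<Longrightarrow> ext_eq p r"
proof (induction arbitrary: r rule: ext_eq.induct)
  case (1 p q)
  note IH = 1(1-4)
  from \<open>ext_eq q r\<close> show ?case
  proof (cases rule: ext_eq.cases)
    case 1
    show ?thesis
    proof (rule ext_eq.intros)
      show "\<forall>x\<in>pre_left p. \<exists>z\<in>pre_left r. ext_eq x z" using IH(1) 1(1) by fast
      show "\<forall>z\<in>pre_left r. \<exists>x\<in>pre_left p. ext_eq x z" using IH(2) 1(2) by fast
      show "\<forall>x\<in>pre_right p. \<exists>z\<in>pre_right r. ext_eq x z" using IH(3) 1(3) by fast
      show "\<forall>z\<in>pre_right r. \<exists>x\<in>pre_right p. ext_eq x z" using IH(4) 1(4) by fast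
    qed
  qed
qed

quotient_type 'i game = "'i pre_game" / ext_eq
proof (rule equivpI)
  show "reflp ext_eq" by (rule reflpI) (rule ext_eq_refl)
  show "symp ext_eq" by (rule sympI) (rule ext_eq_sym)
  show "transp ext_eq" by (rule transpI) (rule ext_eq_trans)
qed

definition left_opts :: "'i game \<Rightarrow> 'i game set" where
  "left_opts G = abs_game ` pre_left (rep_game G)"

definition right_opts :: "'i game \<Rightarrow> 'i game set" where
  "right_opts G = abs_game ` pre_right (rep_game G)"

lemma abs_game_eq_iff: "abs_game p = abs_game q \<longleftrightarrow> ext_eq p q"
  using Quotient_rel[OF Quotient_game, of p q] ext_eq_refl by blast

lemma abs_image_eq_iff:
  "abs_game ` A = abs_game ` B
     \<longleftrightarrow> (\<forall>x\<in>A. \<exists>y\<in>B. ext_eq x y) \<and> (\<forall>y\<in>B. \<exists>x\<in>A. ext_eq x y)"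
proof -
  have "abs_game ` A = abs_game ` B \<longleftrightarrow>
      (\<forall>x\<in>A. \<exists>y\<in>B. abs_game x = abs_game y) \<and> (\<forall>y\<in>B. \<exists>x\<in>A. abs_game x = abs_game y)"
    by (auto simp: set_eq_subset subset_iff image_iff) metis+
  then show ?thesis by (simp only: abs_game_eq_iff)
qed

lemma ext_eq_iff:
  "ext_eq p q \<longleftrightarrow> abs_game ` pre_left p = abs_game ` pre_left q
     \<and> abs_game ` pre_right p = abs_game ` pre_right q"
  unfolding abs_image_eq_iff by (subst ext_eq.simps) blast

lemma ext_eq_rep_abs: "ext_eq (rep_game (abs_game p)) p"
  unfolding abs_game_eq_iff[symmetric] by (rule Quotient_abs_rep[OF Quotient_game])

lemma left_opts_abs: "left_opts (abs_game p) = abs_game ` pre_left p"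
  unfolding left_opts_def using ext_eq_rep_abs[of p] by (simp add: ext_eq_iff)

lemma right_opts_abs: "right_opts (abs_game p) = abs_game ` pre_right p"
  unfolding right_opts_def using ext_eq_rep_abs[of p] by (simp add: ext_eq_iff)

lemma abs_game_cases: obtains p where "G = abs_game p"
  using Quotient_abs_rep[OF Quotient_game, of G] by metis

theorem game_eqI:
  assumes "left_opts G = left_opts H" and "right_opts G = right_opts H"
  shows "G = H"
proof -
  obtain p where p: "G = abs_game p" by (rule abs_game_cases)
  obtain q where q: "H = abs_game q" by (rule abs_game_cases)
  have "ext_eq p q"
    using assms unfolding p q left_opts_abs right_opts_abs ext_eq_iff by simp
  then show ?thesis by (simp add: p q abs_game_eq_iff)
qed

theorem game_induct [case_names opts]:
  assumes "\<And>G. (\<And>X. X \<in> left_opts G \<Longrightarrow> P X) \<Longrightarrow> (\<And>X. X \<in> right_opts G \<Longrightarrow> P X) \<Longrightarrow> P G"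
  shows "P G"
proof -
  have "P (abs_game p)" for p
    by (induction p rule: pre_game_induct)
      (rule assms; auto simp: left_opts_abs right_opts_abs)
  then show ?thesis using abs_game_cases[of G] by auto
qed

definition small :: "'i game set \<Rightarrow> bool" where
  "small A \<longleftrightarrow> A \<lesssim> (UNIV :: ('i + nat) set)"

text \<open>\<open>Game A B\<close> is the game \<open>{ A | B }\<close>; it is meaningful for small \<open>A\<close> and \<open>B\<close> only.\<close>

definition Game :: "'i game set \<Rightarrow> 'i game set \<Rightarrow> 'i game" where
  "Game A B = (THE G. left_opts G = A \<and> right_opts G = B)"

lemma small_imp_ran:
  fixes A :: "'i game set"
  assumes "small A"
  obtains f :: "'i + nat \<Rightarrow> 'i pre_game option" where "abs_game ` ran f = A"
proof -
  obtain e :: "'i game \<Rightarrow> 'i + nat" where e: "inj_on e A"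
    using assms unfolding small_def lepoll_def by blast
  define f where
    "f = (\<lambda>i. if i \<in> e ` A then Some (rep_game (the_inv_into A e i)) else None)"
  have "ran f = rep_game ` A"
  proof (intro equalityI subsetI)
    fix q assume "q \<in> ran f"
    then obtain i where "f i = Some q" by (auto simp: ran_def)
    then show "q \<in> rep_game ` A"
      using e by (auto simp: f_def the_inv_into_f_f split: if_splits)
  next
    fix q assume "q \<in> rep_game ` A"
    then obtain X where "X \<in> A" "q = rep_game X" by auto
    then have "f (e X) = Some q" using e by (simp add: f_def the_inv_into_f_f)
    then show "q \<in> ran f" by (rule ranI)
  qed
  then have "abs_game ` ran f = A"
    by (simp add: image_image Quotient_abs_rep[OF Quotient_game])
  then show thesis by (rule that)
qed

theorem Game_opts:
  fixes A B :: "'i game set"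
  assumes "small A" "small B"
  shows left_opts_Game: "left_opts (Game A B) = A"
    and right_opts_Game: "right_opts (Game A B) = B"
proof -
  obtain l :: "'i + nat \<Rightarrow> 'i pre_game option" where l: "abs_game ` ran l = A" using assms(1) by (rule small_imp_ran)
  obtain r :: "'i + nat \<Rightarrow> 'i pre_game option" where r: "abs_game ` ran r = B" using assms(2) by (rule small_imp_ran)
  have "left_opts (abs_game (Pre_Game l r)) = A \<and> right_opts (abs_game (Pre_Game l r)) = B"
    by (simp add: left_opts_abs right_opts_abs l r)
  then have "\<exists>!G. left_opts G = A \<and> right_opts G = B"
    by (metis game_eqI)
  then have "left_opts (Game A B) = A \<and> right_opts (Game A B) = B"
    unfolding Game_def by (rule theI')
  then show "left_opts (Game A B) = A" "right_opts (Game A B) = B" by auto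
qed

lemma small_imageI:
  assumes "A \<lesssim> (UNIV :: ('i + nat) set)"
  shows "small (f ` A :: 'i game set)"
  unfolding small_def by (rule lepoll_trans[OF image_lepoll assms])

lemma small_ran: "small (abs_game ` ran (f :: 'i + nat \<Rightarrow> 'i pre_game option))"
proof -
  have "ran f \<subseteq> range (the \<circ> f)"
  proof
    fix q assume "q \<in> ran f"
    then obtain i where "f i = Some q" by (auto simp: ran_def)
    then have "q = (the \<circ> f) i" by simp
    then show "q \<in> range (the \<circ> f)" by (rule range_eqI)
  qed
  then have "ran f \<lesssim> (UNIV :: ('i + nat) set)"
    by (rule subset_image_lepoll)
  then show ?thesis by (rule small_imageI)
qed

theorem small_left_opts: "small (left_opts G)"
proof -
  obtain l r where "rep_game G = Pre_Game l r" by (rule pre_game.exhaust)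
  then have eq: "left_opts G = abs_game ` ran l" by (simp add: left_opts_def)
  show ?thesis unfolding eq by (rule small_ran)
qed

theorem small_right_opts: "small (right_opts G)"
proof -
  obtain l r where "rep_game G = Pre_Game l r" by (rule pre_game.exhaust)
  then have eq: "right_opts G = abs_game ` ran r" by (simp add: right_opts_def)
  show ?thesis unfolding eq by (rule small_ran)
qed

lemma small_image: "small A \<Longrightarrow> small (f ` A)" for f :: "'i game \<Rightarrow> 'i game"
  unfolding small_def[of A] by (rule small_imageI)

lemma infinite_index: "infinite (UNIV :: ('i + nat) set)"
  by (simp add: finite_Plus_UNIV_iff)

lemma small_iff_card_of: "small (A :: 'i game set) \<longleftrightarrow> (card_of A, card_of (UNIV :: ('i + nat) set)) \<in> ordLeq"
  unfolding small_def lepoll_def by (rule card_of_ordLeq)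

lemma small_Un: "small A \<Longrightarrow> small B \<Longrightarrow> small (A \<union> B)"
  unfolding small_iff_card_of
  by (rule card_of_Un_ordLeq_infinite_Field)
    (simp_all only: infinite_index Field_card_of card_of_card_order_on not_False_eq_True)

lemma small_image_Times:
  fixes A B :: "'i game set" and f :: "'i game \<times> 'i game \<Rightarrow> 'i game"
  assumes "small A" "small B"
  shows "small (f ` (A \<times> B))"
proof (rule small_imageI)
  have "(card_of (A \<times> B), card_of (UNIV :: ('i + nat) set)) \<in> ordLeq"
    using assms unfolding small_iff_card_of
    by (intro card_of_Sigma_ordLeq_infinite[OF infinite_index]) auto
  then show "A \<times> B \<lesssim> (UNIV :: ('i + nat) set)"
    unfolding lepoll_def by (simp only: card_of_ordLeq)
qed


lemmas small_intros = small_Un small_image small_image_Times small_left_opts small_right_opts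


section \<open>Operations\<close>

definition game_option :: "('i game \<times> 'i game) set" where
  "game_option = {(X, G). X \<in> left_opts G \<union> right_opts G}"

lemma wf_game_option: "wf game_option"
proof (rule wfUNIVI)
  fix P :: "'i game \<Rightarrow> bool" and G
  assume step: "\<forall>G. (\<forall>X. (X, G) \<in> game_option \<longrightarrow> P X) \<longrightarrow> P G"
  show "P G"
  proof (induction G rule: game_induct)
    case (opts G)
    have "P X" if "(X, G) \<in> game_option" for X
      using that opts unfolding game_option_def by blast
    with step show ?case by blast
  qed
qed

lemma game_option_intros:
  "X \<in> left_opts G \<Longrightarrow> (X, G) \<in> game_option"
  "X \<in> right_opts G \<Longrightarrow> (X, G) \<in> game_option"
  by (simp_all add: game_option_def)

text \<open>
  The functions below follow the recursive definitions of the operations, with the set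
  comprehensions written as images; the theorems after them restate the option sets as usual.
\<close>

instantiation game :: (type) "{plus, uminus, minus, times}"
begin

function plus_game :: "'a game \<Rightarrow> 'a game \<Rightarrow> 'a game" where
  "plus_game G H = Game
     ((\<lambda>X. plus_game X H) ` left_opts G \<union> (\<lambda>Y. plus_game G Y) ` left_opts H)
     ((\<lambda>X. plus_game X H) ` right_opts G \<union> (\<lambda>Y. plus_game G Y) ` right_opts H)"
  by auto
termination
  by (relation "game_option <*lex*> game_option")
    (auto simp: wf_game_option intro: game_option_intros)

function uminus_game :: "'a game \<Rightarrow> 'a game" where
  "uminus_game G = Game (uminus_game ` right_opts G) (uminus_game ` left_opts G)"
  by auto
termination
  by (relation game_option) (auto simp: wf_game_option intro: game_option_intros)

declare plus_game.simps [simp del] uminus_game.simps [simp del]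

definition minus_game :: "'a game \<Rightarrow> 'a game \<Rightarrow> 'a game" where
  "G - H = G + (- H)" for G H :: "'a game"

function times_game :: "'a game \<Rightarrow> 'a game \<Rightarrow> 'a game" where
  "times_game G H = Game
     ((\<lambda>(X, Y). times_game X H + times_game G Y - times_game X Y)
          ` (left_opts G \<times> left_opts H)
      \<union> (\<lambda>(X, Y). times_game X H + times_game G Y - times_game X Y)
          ` (right_opts G \<times> right_opts H))
     ((\<lambda>(X, Y). times_game X H + times_game G Y - times_game X Y)
          ` (left_opts G \<times> right_opts H)
      \<union> (\<lambda>(X, Y). times_game X H + times_game G Y - times_game X Y)
          ` (right_opts G \<times> left_opts H))"
  by auto
termination
  by (relation "game_option <*lex*> game_option")
    (auto simp: wf_game_option intro: game_option_intros)

declare times_game.simps [simp del]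

instance ..

end

theorem left_opts_plus:
  "left_opts (G + H) = {X + H |X. X \<in> left_opts G} \<union> {G + Y |Y. Y \<in> left_opts H}"
  by (simp add: plus_game.simps[of G H] left_opts_Game small_intros) auto

theorem right_opts_plus:
  "right_opts (G + H) = {X + H |X. X \<in> right_opts G} \<union> {G + Y |Y. Y \<in> right_opts H}"
  by (simp add: plus_game.simps[of G H] right_opts_Game small_intros) auto

theorem left_opts_uminus: "left_opts (- G) = {- X |X. X \<in> right_opts G}"
  by (simp add: uminus_game.simps[of G] left_opts_Game small_intros) auto

theorem right_opts_uminus: "right_opts (- G) = {- X |X. X \<in> left_opts G}"
  by (simp add: uminus_game.simps[of G] right_opts_Game small_intros) auto

theorem left_opts_times:
  "left_opts (G * H) =
     {X * H + G * Y - X * Y |X Y. X \<in> left_opts G \<and> Y \<in> left_opts H}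
     \<union> {X * H + G * Y - X * Y |X Y. X \<in> right_opts G \<and> Y \<in> right_opts H}"
  by (simp add: times_game.simps[of G H] left_opts_Game small_intros) auto

theorem right_opts_times:
  "right_opts (G * H) =
     {X * H + G * Y - X * Y |X Y. X \<in> left_opts G \<and> Y \<in> right_opts H}
     \<union> {X * H + G * Y - X * Y |X Y. X \<in> right_opts G \<and> Y \<in> left_opts H}"
  by (simp add: times_game.simps[of G H] right_opts_Game small_intros) auto


section \<open>Iteratively zero and Conway zero games\<close>

inductive iteratively_zero :: "'i game \<Rightarrow> bool" where
  "\<lbrakk>\<forall>X\<in>left_opts G. \<exists>Z\<in>right_opts X. iteratively_zero Z;
    \<forall>X\<in>right_opts G. \<exists>Z\<in>left_opts X. iteratively_zero Z\<rbrakk> \<Longrightarrow> iteratively_zero G"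

datatype player = Left | Right

primrec opponent :: "player \<Rightarrow> player" where
  "opponent Left = Right"
| "opponent Right = Left"

primrec options :: "player \<Rightarrow> 'i game \<Rightarrow> 'i game set" where
  "options Left G = left_opts G"
| "options Right G = right_opts G"

text \<open>
  A strategy of the second player \<open>P\<close> assigns a reply to every position in which \<open>P\<close> is to move.
  \<open>reached P \<sigma> G X\<close> means that, when the opponent of \<open>P\<close> starts on \<open>G\<close> and \<open>P\<close> replies according
  to \<open>\<sigma>\<close>, some play leads to the position \<open>X\<close> with the opponent of \<open>P\<close> to move.
\<close>

inductive reached :: "player \<Rightarrow> ('i game \<Rightarrow> 'i game) \<Rightarrow> 'i game \<Rightarrow> 'i game \<Rightarrow> bool"
  for P \<sigma> G where
  start: "reached P \<sigma> G G"
| round: "\<lbrakk>reached P \<sigma> G X; Y \<in> options (opponent P) X; \<sigma> Y \<in> options P Y\<rbrakk>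
    \<Longrightarrow> reached P \<sigma> G (\<sigma> Y)"

text \<open>
  Under normal play a player unable to move loses, and by well-foundedness every play ends.  So
  \<open>P\<close> wins every play consistent with \<open>\<sigma>\<close> iff \<open>\<sigma>\<close> always provides a legal reply.
\<close>

definition winning_as_second :: "player \<Rightarrow> ('i game \<Rightarrow> 'i game) \<Rightarrow> 'i game \<Rightarrow> bool" where
  "winning_as_second P \<sigma> G \<longleftrightarrow>
     (\<forall>X Y. reached P \<sigma> G X \<and> Y \<in> options (opponent P) X \<longrightarrow> \<sigma> Y \<in> options P Y)"

definition conway_zero :: "'i game \<Rightarrow> bool" where
  "conway_zero G \<longleftrightarrow> (\<forall>P. \<exists>\<sigma>. winning_as_second P \<sigma> G)"

end

(* In G * H the second player answers X * H + G * Y - X * Y, with X an option of G and Y an option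
   of H, by moving in X * H to Z * H + X * Y - Z * Y, where Z is an iteratively zero reply to X.
   The products with Z are iteratively zero by induction on G and G * Y by induction on H, while
   X * Y cancels its negative by mirroring. Since addition of forms is commutative and associative
   up to equality of forms, the result is a sum of iteratively zero games, hence iteratively zero. *)
theory Submission
  imports Defs
begin

lemma opponent_opponent [simp]: "opponent (opponent P) = P"
  by (cases P) auto

lemma options_plus:
  "options P (G + H) = (\<lambda>X. X + H) ` options P G \<union> (\<lambda>Y. G + Y) ` options P H"
  by (cases P) (auto simp: left_opts_plus right_opts_plus)

lemma options_uminus: "options P (- G) = uminus ` options (opponent P) G"
  by (cases P) (auto simp: left_opts_uminus right_opts_uminus)

text \<open>Left's moves in a product take the options of both factors from the same side, Right's
  from opposite sides. With \<open>Q\<close> the side taken in \<open>G\<close>, the player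
  \<open>P\<close> determines the side in \<open>H\<close>, so one argument can treat both
  players.\<close>

lemma options_times:
  "options P (G * H) =
     {X * H + G * Y - X * Y |Q X Y.
        X \<in> options Q G \<and> Y \<in> options (if P = Left then Q else opponent Q) H}"
proof -
  have ex_player: "(\<exists>Q. R Q) \<longleftrightarrow> R Left \<or> R Right" for R
    by (metis player.exhaust)
  show ?thesis
    by (cases P) (auto simp: left_opts_times right_opts_times ex_player)
qed

lemma game_eq_optionsI: "(\<And>P. options P G = options P H) \<Longrightarrow> G = H"
  by (rule game_eqI) (metis options.simps(1), metis options.simps(2))

lemma options_induct [case_names options]:
  assumes "\<And>G. (\<And>P X. X \<in> options P G \<Longrightarrow> R X) \<Longrightarrow> R G"
  shows "R G"
proof (induction G rule: game_induct)
  case (opts G)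
  show ?case
  proof (rule assms)
    fix P X assume "X \<in> options P G"
    then show "R X" using opts by (cases P) auto
  qed
qed

text \<open>Equality of forms is needed here: \<open>iteratively_zero\<close> is not invariant under
  equality of values. For instance, { { | -1 } | } has value 0 but is not iteratively zero.\<close>

lemma game_add_commute: "G + H = H + G" for G H :: "'i game"
proof (induction G arbitrary: H rule: options_induct)
  case (options G)
  note IH_G = options
  show ?case
  proof (induction H rule: options_induct)
    case (options H)
    show ?case
    proof (rule game_eq_optionsI)
      fix P
      have "(\<lambda>X. X + H) ` options P G = (\<lambda>X. H + X) ` options P G"
        using IH_G by (intro image_cong) auto
      moreover have "(\<lambda>Y. G + Y) ` options P H = (\<lambda>Y. Y + G) ` options P H"
        using options by (intro image_cong) auto
      ultimately show "options P (G + H) = options P (H + G)"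
        unfolding options_plus by blast
    qed
  qed
qed

text \<open>A move changes exactly one of the three summands, so each bracketing has three families
  of options, matched by the induction on the summand moved in.\<close>

lemma game_add_assoc: "(G + H) + K = G + (H + K)" for G H K :: "'i game"
proof (induction G arbitrary: H K rule: options_induct)
  case (options G)
  note IH_G = options
  show ?case
  proof (induction H arbitrary: K rule: options_induct)
    case (options H)
    note IH_H = options
    show ?case
    proof (induction K rule: options_induct)
      case (options K)
      show ?case
      proof (rule game_eq_optionsI)
        fix P
        have "(\<lambda>X. (X + H) + K) ` options P G = (\<lambda>X. X + (H + K)) ` options P G"
          using IH_G by (intro image_cong) auto
        moreover have "(\<lambda>Y. (G + Y) + K) ` options P H = (\<lambda>Y. G + (Y + K)) ` options P H"
          using IH_H by (intro image_cong) auto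
        moreover have "(\<lambda>Z. (G + H) + Z) ` options P K = (\<lambda>Z. G + (H + Z)) ` options P K"
          using options by (intro image_cong) auto
        ultimately show "options P ((G + H) + K) = options P (G + (H + K))"
          by (simp add: options_plus image_Un image_image Un_assoc)
      qed
    qed
  qed
qed

lemma iteratively_zero_iff:
  "iteratively_zero G \<longleftrightarrow>
     (\<forall>P. \<forall>X\<in>options P G. \<exists>Z\<in>options (opponent P) X. iteratively_zero Z)"
proof -
  have all_player: "(\<forall>P. R P) \<longleftrightarrow> R Left \<and> R Right" for R
    by (metis player.exhaust)
  show ?thesis
    by (subst iteratively_zero.simps) (simp add: all_player)
qed

lemma iteratively_zeroI:
  assumes "\<And>P X. X \<in> options P G \<Longrightarrow> \<exists>Z\<in>options (opponent P) X. iteratively_zero Z"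
  shows "iteratively_zero G"
  using assms by (subst iteratively_zero_iff) blast

lemma iteratively_zero_reply:
  assumes "iteratively_zero G" "X \<in> options P G"
  obtains Z where "Z \<in> options (opponent P) X" "iteratively_zero Z"
  using assms by (subst (asm) iteratively_zero_iff) blast

text \<open>The second player replies in the summand in which the opponent has just moved.\<close>

lemma iteratively_zero_plus:
  assumes "iteratively_zero G" "iteratively_zero H"
  shows "iteratively_zero (G + H)"
  using assms
proof (induction G arbitrary: H rule: iteratively_zero.induct)
  case (1 G)
  have IH_G: "\<exists>Z\<in>options (opponent P) X. \<forall>K. iteratively_zero K \<longrightarrow> iteratively_zero (Z + K)"
    if "X \<in> options P G" for P X
    using 1(1,2) that by (cases P) fastforce+
  from 1(3) show ?case
  proof (induction H rule: iteratively_zero.induct)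
    case (1 H)
    \<comment> \<open>After a reply in \<open>G\<close> the summand \<open>H\<close> is still
      untouched, so \<open>H\<close> itself is needed here, not only the replies to its
      options.\<close>
    have H: "iteratively_zero H"
      using 1 by (blast intro: iteratively_zero.intros)
    have IH_H: "\<exists>Z\<in>options (opponent P) Y. iteratively_zero (G + Z)"
      if "Y \<in> options P H" for P Y
      using 1 that by (cases P) fastforce+
    show ?case
    proof (rule iteratively_zeroI)
      fix P U assume "U \<in> options P (G + H)"
      then consider X where "X \<in> options P G" "U = X + H"
        | Y where "Y \<in> options P H" "U = G + Y"
        by (auto simp: options_plus)
      then show "\<exists>Z\<in>options (opponent P) U. iteratively_zero Z"
      proof cases
        case 1
        then show ?thesis using IH_G[OF 1(1)] H by (fastforce simp: options_plus)
      next
        case 2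
        then show ?thesis using IH_H[OF 2(1)] by (fastforce simp: options_plus)
      qed
    qed
  qed
qed

lemma iteratively_zero_uminus:
  assumes "iteratively_zero G"
  shows "iteratively_zero (- G)"
  using assms
proof (induction G rule: iteratively_zero.induct)
  case (1 G)
  have IH: "\<exists>Z\<in>options P X. iteratively_zero (- Z)"
    if "X \<in> options (opponent P) G" for P X
    using 1 that by (cases P) fastforce+
  show ?case
  proof (rule iteratively_zeroI)
    fix P U assume "U \<in> options P (- G)"
    then obtain X where X: "X \<in> options (opponent P) G" "U = - X"
      by (auto simp: options_uminus)
    then show "\<exists>Z\<in>options (opponent P) U. iteratively_zero Z"
      using IH[OF X(1)] by (auto simp: options_uminus)
  qed
qed

text \<open>Every move is copied in the other summand, which leaves \<open>X + - X\<close> for an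
  option \<open>X\<close> of \<open>G\<close>.\<close>

lemma iteratively_zero_cancel: "iteratively_zero (G + - G)"
proof (induction G rule: options_induct)
  case (options G)
  show ?case
  proof (rule iteratively_zeroI)
    fix P U assume "U \<in> options P (G + - G)"
    then consider X where "X \<in> options P G" "U = X + - G"
      | X where "X \<in> options (opponent P) G" "U = G + - X"
      by (auto simp: options_plus options_uminus)
    then show "\<exists>Z\<in>options (opponent P) U. iteratively_zero Z"
    proof cases
      case (1 X)
      then have "X + - X \<in> options (opponent P) U"
        by (auto simp: options_plus options_uminus)
      then show ?thesis using options[OF 1(1)] by blast
    next
      case (2 X)
      then have "X + - X \<in> options (opponent P) U"
        by (auto simp: options_plus)
      then show ?thesis using options[OF 2(1)] by blast
    qed
  qed
qed

lemma iteratively_zero_times: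
  assumes "iteratively_zero G"
  shows "iteratively_zero (G * H)"
  using assms
proof (induction G arbitrary: H rule: iteratively_zero.induct)
  case (1 G)
  \<comment> \<open>The reply \<open>Z\<close> is fixed before the factor \<open>K\<close>, because
    the same \<open>Z\<close> is used below with both \<open>H\<close> and \<open>Y\<close>.\<close>
  have IH_G: "\<exists>Z\<in>options (opponent Q) X. \<forall>K. iteratively_zero (Z * K)"
    if "X \<in> options Q G" for Q X
    using 1 that by (cases Q) fastforce+
  show ?case
  proof (induction H rule: options_induct)
    case (options H)
    show ?case
    proof (rule iteratively_zeroI)
      fix P U assume "U \<in> options P (G * H)"
      then obtain Q X Y where X: "X \<in> options Q G"
        and Y: "Y \<in> options (if P = Left then Q else opponent Q) H"
        and U: "U = X * H + G * Y - X * Y"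
        by (auto simp: options_times)
      from IH_G[OF X] obtain Z where Z: "Z \<in> options (opponent Q) X"
        and Z_times: "\<And>K. iteratively_zero (Z * K)" by blast
      let ?V = "Z * H + X * Y - Z * Y"
      \<comment> \<open>Passing from \<open>X\<close> to \<open>Z\<close> switches the side in the
        first factor just when the player to move switches, so the same \<open>Y\<close> is
        admissible for the reply in \<open>X * H\<close>.\<close>
      have "Y \<in> options (if opponent P = Left then opponent Q else opponent (opponent Q)) H"
        using Y by (cases P) auto
      with Z have "?V \<in> options (opponent P) (X * H)"
        unfolding options_times by blast
      then have "?V + G * Y - X * Y \<in> options (opponent P) U"
        by (auto simp: U minus_game_def options_plus)
      \<comment> \<open>The regrouping brings \<open>X * Y\<close>, which need not be iteratively
        zero, next to its negative.\<close>
      moreover have "?V + G * Y - X * Y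
          = Z * H + (- (Z * Y) + (G * Y + (X * Y + - (X * Y))))"
        unfolding minus_game_def by (metis game_add_assoc game_add_commute)
      moreover have "iteratively_zero (Z * H + (- (Z * Y) + (G * Y + (X * Y + - (X * Y)))))"
        by (intro iteratively_zero_plus iteratively_zero_uminus iteratively_zero_cancel
            Z_times options[OF Y])
      ultimately show "\<exists>Z\<in>options (opponent P) U. iteratively_zero Z" by metis
    qed
  qed
qed

lemma iteratively_zero_imp_conway_zero:
  fixes G :: "'i game"
  assumes "iteratively_zero G"
  shows "conway_zero G"
  unfolding conway_zero_def
proof
  fix P
  \<comment> \<open>The reply depends on the current position alone. Its value is arbitrary where no
    iteratively zero reply exists, which never happens after a move from an iteratively zero
    position.\<close>
  define \<sigma> :: "'i game \<Rightarrow> 'i game"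
    where "\<sigma> Y = (SOME Z. Z \<in> options P Y \<and> iteratively_zero Z)" for Y
  have reply: "\<sigma> Y \<in> options P Y \<and> iteratively_zero (\<sigma> Y)"
    if "iteratively_zero X" "Y \<in> options (opponent P) X" for X Y
  proof -
    from that obtain Z where "Z \<in> options P Y \<and> iteratively_zero Z"
      by (metis iteratively_zero_reply opponent_opponent)
    then show ?thesis unfolding \<sigma>_def by (rule someI)
  qed
  \<comment> \<open>This is the invariant of play: the opponent always faces an iteratively zero
    position, so the next reply exists.\<close>
  have "iteratively_zero X" if "reached P \<sigma> G X" for X
    using that by induction (use assms reply in blast)+
  then have "winning_as_second P \<sigma> G"
    unfolding winning_as_second_def using reply by blast
  then show "\<exists>\<sigma>. winning_as_second P \<sigma> G" by blast
qed

theorem theorem3p4: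
  fixes G H :: "'i game"
  assumes "iteratively_zero G"
  shows "iteratively_zero (G * H) \<and> conway_zero (G * H)"
  using iteratively_zero_times[OF assms] iteratively_zero_imp_conway_zero by blast

end
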